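(* Let $(A,\sigma)$ be a state-morphism BL-algebra. Then $(A,\sigma)$ is simple if and only if $\mathrm{Ker}(\sigma)$ is a maximal filter of $A$.
   Context: A BL-algebra is an algebra $(A,\wedge,\vee,\odot,\to,0,1)$ of type $(2,2,2,2,0,0)$ such that $(A,\wedge,\vee,0,1)$ is a bounded lattice, $(A,\odot,1)$ is a commutative monoid, and for all $a,b,c\in A$: $c\le a\to b$ iff $a\odot c\le b$; $a\wedge b=a\odot(a\to b)$; $(a\to b)\vee(b\to a)=1$. A morphism-state-operator on $A$ is a map $\sigma:A\to A$ such that for all $x,y\in A$: $\sigma(0)=0$; $\sigma(x\to y)=\sigma(x)\to\sigma(x\wedge y)$; $\sigma(\sigma(x)\odot\sigma(y))=\sigma(x)\odot\sigma(y)$; $\sigma(\sigma(x)\to\sigma(y))=\sigma(x)\to\sigma(y)$; $\sigma(x\odot y)=\sigma(x)\odot\sigma(y)$; then $(A,\sigma)$ is a state-morphism BL-algebra. The image $\sigma(A)$ is a subalgebra of $A$, regarded as a BL-algebra. $\mathrm{Ker}(\sigma)=\{x\in A:\sigma(x)=1\}$. A filter is a nonempty subset closed under $\odot$ and upward closed; a maximal filter is a proper filter not strictly contained in another proper filter. A BL-algebra is simple if it has exactly two filters. A state BL-algebra $(A,\sigma)$ is called simple if the BL-algebra $\sigma(A)$ is simple. *)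

theory Defs
  imports "HOL-Algebra.Group"
begin

text \<open>The monoid part of the record (\<open>mult\<close>, \<open>one\<close>) carries the strong conjunction and the top
  element of the BL-algebra.\<close>

record 'a bl_signature = "'a monoid" +
  bl_meet :: "'a \<Rightarrow> 'a \<Rightarrow> 'a" (infixl "\<curlywedge>\<index>" 70)
  bl_join :: "'a \<Rightarrow> 'a \<Rightarrow> 'a" (infixl "\<curlyvee>\<index>" 65)
  bl_imp :: "'a \<Rightarrow> 'a \<Rightarrow> 'a" (infixr "\<rightharpoonup>\<index>" 60)
  bl_zero :: 'a ("\<zero>\<index>")

definition bl_le :: "('a, 'm) bl_signature_scheme \<Rightarrow> 'a \<Rightarrow> 'a \<Rightarrow> bool" (infix "\<preceq>\<index>" 50)
  where "x \<preceq>\<^bsub>A\<^esub> y \<longleftrightarrow> x \<curlywedge>\<^bsub>A\<^esub> y = x"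

locale bl_algebra = comm_monoid A for A :: "('a, 'm) bl_signature_scheme" (structure) +
  assumes meet_closed: "\<lbrakk>x \<in> carrier A; y \<in> carrier A\<rbrakk> \<Longrightarrow> x \<curlywedge> y \<in> carrier A"
    and join_closed: "\<lbrakk>x \<in> carrier A; y \<in> carrier A\<rbrakk> \<Longrightarrow> x \<curlyvee> y \<in> carrier A"
    and imp_closed: "\<lbrakk>x \<in> carrier A; y \<in> carrier A\<rbrakk> \<Longrightarrow> x \<rightharpoonup> y \<in> carrier A"
    and zero_closed: "\<zero> \<in> carrier A"
    and meet_commute: "\<lbrakk>x \<in> carrier A; y \<in> carrier A\<rbrakk> \<Longrightarrow> x \<curlywedge> y = y \<curlywedge> x"
    and join_commute: "\<lbrakk>x \<in> carrier A; y \<in> carrier A\<rbrakk> \<Longrightarrow> x \<curlyvee> y = y \<curlyvee> x"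
    and meet_assoc: "\<lbrakk>x \<in> carrier A; y \<in> carrier A; z \<in> carrier A\<rbrakk>
      \<Longrightarrow> (x \<curlywedge> y) \<curlywedge> z = x \<curlywedge> (y \<curlywedge> z)"
    and join_assoc: "\<lbrakk>x \<in> carrier A; y \<in> carrier A; z \<in> carrier A\<rbrakk>
      \<Longrightarrow> (x \<curlyvee> y) \<curlyvee> z = x \<curlyvee> (y \<curlyvee> z)"
    and meet_join_absorb: "\<lbrakk>x \<in> carrier A; y \<in> carrier A\<rbrakk> \<Longrightarrow> x \<curlywedge> (x \<curlyvee> y) = x"
    and join_meet_absorb: "\<lbrakk>x \<in> carrier A; y \<in> carrier A\<rbrakk> \<Longrightarrow> x \<curlyvee> (x \<curlywedge> y) = x"
    and zero_least: "x \<in> carrier A \<Longrightarrow> \<zero> \<preceq> x"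
    and one_greatest: "x \<in> carrier A \<Longrightarrow> x \<preceq> \<one>"
    and residuation: "\<lbrakk>a \<in> carrier A; b \<in> carrier A; c \<in> carrier A\<rbrakk>
      \<Longrightarrow> c \<preceq> (a \<rightharpoonup> b) \<longleftrightarrow> a \<otimes> c \<preceq> b"
    and divisibility: "\<lbrakk>a \<in> carrier A; b \<in> carrier A\<rbrakk> \<Longrightarrow> a \<curlywedge> b = a \<otimes> (a \<rightharpoonup> b)"
    and prelinearity: "\<lbrakk>a \<in> carrier A; b \<in> carrier A\<rbrakk> \<Longrightarrow> (a \<rightharpoonup> b) \<curlyvee> (b \<rightharpoonup> a) = \<one>"

definition bl_filter :: "('a, 'm) bl_signature_scheme \<Rightarrow> 'a set \<Rightarrow> bool"
  where "bl_filter A F \<longleftrightarrow> F \<subseteq> carrier A \<and> F \<noteq> {} \<and>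
    (\<forall>x\<in>F. \<forall>y\<in>F. x \<otimes>\<^bsub>A\<^esub> y \<in> F) \<and>
    (\<forall>x\<in>F. \<forall>y\<in>carrier A. x \<preceq>\<^bsub>A\<^esub> y \<longrightarrow> y \<in> F)"

definition bl_proper_filter :: "('a, 'm) bl_signature_scheme \<Rightarrow> 'a set \<Rightarrow> bool"
  where "bl_proper_filter A F \<longleftrightarrow> bl_filter A F \<and> F \<noteq> carrier A"

definition bl_maximal_filter :: "('a, 'm) bl_signature_scheme \<Rightarrow> 'a set \<Rightarrow> bool"
  where "bl_maximal_filter A F \<longleftrightarrow> bl_proper_filter A F \<and>
    \<not> (\<exists>G. bl_proper_filter A G \<and> F \<subset> G)"

definition simple_bl_algebra :: "('a, 'm) bl_signature_scheme \<Rightarrow> bool"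
  where "simple_bl_algebra A \<longleftrightarrow> bl_algebra A \<and> card {F. bl_filter A F} = 2"

locale state_morphism_bl_algebra = bl_algebra A
  for A :: "('a, 'm) bl_signature_scheme" (structure) +
  fixes \<sigma> :: "'a \<Rightarrow> 'a"
  assumes state_closed: "x \<in> carrier A \<Longrightarrow> \<sigma> x \<in> carrier A"
    and state_zero: "\<sigma> \<zero> = \<zero>"
    and state_imp: "\<lbrakk>x \<in> carrier A; y \<in> carrier A\<rbrakk>
      \<Longrightarrow> \<sigma> (x \<rightharpoonup> y) = \<sigma> x \<rightharpoonup> \<sigma> (x \<curlywedge> y)"
    and state_mult_image: "\<lbrakk>x \<in> carrier A; y \<in> carrier A\<rbrakk>
      \<Longrightarrow> \<sigma> (\<sigma> x \<otimes> \<sigma> y) = \<sigma> x \<otimes> \<sigma> y"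
    and state_imp_image: "\<lbrakk>x \<in> carrier A; y \<in> carrier A\<rbrakk>
      \<Longrightarrow> \<sigma> (\<sigma> x \<rightharpoonup> \<sigma> y) = \<sigma> x \<rightharpoonup> \<sigma> y"
    and state_mult: "\<lbrakk>x \<in> carrier A; y \<in> carrier A\<rbrakk>
      \<Longrightarrow> \<sigma> (x \<otimes> y) = \<sigma> x \<otimes> \<sigma> y"

definition state_image :: "('a, 'm) bl_signature_scheme \<Rightarrow> ('a \<Rightarrow> 'a) \<Rightarrow> ('a, 'm) bl_signature_scheme"
  where "state_image A \<sigma> = A\<lparr>carrier := \<sigma> ` carrier A\<rparr>"

definition state_kernel :: "('a, 'm) bl_signature_scheme \<Rightarrow> ('a \<Rightarrow> 'a) \<Rightarrow> 'a set"
  where "state_kernel A \<sigma> = {x \<in> carrier A. \<sigma> x = \<one>\<^bsub>A\<^esub>}"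

definition simple_state_bl_algebra :: "('a, 'm) bl_signature_scheme \<Rightarrow> ('a \<Rightarrow> 'a) \<Rightarrow> bool"
  where "simple_state_bl_algebra A \<sigma> \<longleftrightarrow> simple_bl_algebra (state_image A \<sigma>)"

end

theory Submission
  imports Defs
begin

text \<open>The operator \<open>\<sigma>\<close> is idempotent, multiplicative and order preserving. Hence the preimage of a
  filter \<open>F\<close> of \<open>\<sigma>(A)\<close> is a filter of \<open>A\<close> above the kernel, and it is strictly above it as soon as
  \<open>F \<noteq> {1}\<close>, since the elements of \<open>F\<close> are fixed by \<open>\<sigma>\<close>. Conversely, the image of a filter \<open>G\<close> of
  \<open>A\<close> generates a filter of \<open>\<sigma>(A)\<close>; if \<open>G\<close> contains the kernel and this filter contains \<open>0\<close>, then
  \<open>\<sigma>(g) = 0\<close> for some \<open>g \<in> G\<close>, so \<open>\<sigma>(g \<rightarrow> 0) = 1\<close>, both \<open>g\<close> and \<open>g \<rightarrow> 0\<close> lie in \<open>G\<close>, and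
  \<open>G\<close> is not proper.\<close>

section \<open>Order, residuation and subalgebras of a BL-algebra\<close>

context bl_algebra
begin

text \<open>Idempotence of the meet follows from the two absorption laws: rewrite the second
  \<open>x\<close> in \<open>x \<curlywedge> x\<close> as
  \<open>x \<curlyvee> (x \<curlywedge> x)\<close> and absorb.\<close>

lemma le_refl: "x \<in> carrier A \<Longrightarrow> x \<preceq> x"
  unfolding bl_le_def by (metis join_closed join_meet_absorb meet_join_absorb meet_closed)

lemma le_antisym: "\<lbrakk>x \<preceq> y; y \<preceq> x; x \<in> carrier A; y \<in> carrier A\<rbrakk> \<Longrightarrow> x = y"
  unfolding bl_le_def by (metis meet_commute)

lemma le_trans:
  "\<lbrakk>x \<preceq> y; y \<preceq> z; x \<in> carrier A; y \<in> carrier A; z \<in> carrier A\<rbrakk> \<Longrightarrow> x \<preceq> z"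
  unfolding bl_le_def by (metis meet_assoc)

lemma meet_le1: "\<lbrakk>x \<in> carrier A; y \<in> carrier A\<rbrakk> \<Longrightarrow> x \<curlywedge> y \<preceq> x"
  using le_refl unfolding bl_le_def by (metis meet_assoc meet_commute meet_closed)

lemma meet_le2: "\<lbrakk>x \<in> carrier A; y \<in> carrier A\<rbrakk> \<Longrightarrow> x \<curlywedge> y \<preceq> y"
  using meet_le1 meet_commute by metis

lemma meet_greatest:
  "\<lbrakk>z \<preceq> x; z \<preceq> y; x \<in> carrier A; y \<in> carrier A; z \<in> carrier A\<rbrakk> \<Longrightarrow> z \<preceq> x \<curlywedge> y"
  unfolding bl_le_def by (metis meet_assoc)

lemma le_iff_join: "\<lbrakk>x \<in> carrier A; y \<in> carrier A\<rbrakk> \<Longrightarrow> x \<preceq> y \<longleftrightarrow> x \<curlyvee> y = y"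
  unfolding bl_le_def by (metis join_commute join_meet_absorb meet_commute meet_join_absorb)

lemma join_ge1: "\<lbrakk>x \<in> carrier A; y \<in> carrier A\<rbrakk> \<Longrightarrow> x \<preceq> x \<curlyvee> y"
  unfolding bl_le_def by (rule meet_join_absorb)

lemma join_ge2: "\<lbrakk>x \<in> carrier A; y \<in> carrier A\<rbrakk> \<Longrightarrow> y \<preceq> x \<curlyvee> y"
  using join_ge1 join_commute by metis

lemma join_least:
  "\<lbrakk>x \<preceq> z; y \<preceq> z; x \<in> carrier A; y \<in> carrier A; z \<in> carrier A\<rbrakk> \<Longrightarrow> x \<curlyvee> y \<preceq> z"
  by (metis le_iff_join join_assoc join_closed)

lemma mult_imp_le: "\<lbrakk>x \<in> carrier A; y \<in> carrier A\<rbrakk> \<Longrightarrow> x \<otimes> (x \<rightharpoonup> y) \<preceq> y"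
  by (metis divisibility meet_le2)

text \<open>Residuation turns \<open>z \<otimes> y \<preceq> z \<otimes> y\<close> into a bound on
  \<open>y\<close> alone, which \<open>x\<close> inherits; residuating back gives the claim.\<close>

lemma mult_mono_right:
  assumes "x \<preceq> y" "x \<in> carrier A" "y \<in> carrier A" "z \<in> carrier A"
  shows "z \<otimes> x \<preceq> z \<otimes> y"
proof -
  have "y \<preceq> (z \<rightharpoonup> z \<otimes> y)"
    using assms by (simp add: residuation le_refl)
  then have "x \<preceq> (z \<rightharpoonup> z \<otimes> y)"
    using assms by (meson le_trans imp_closed m_closed)
  then show ?thesis
    using assms by (simp add: residuation)
qed

lemma mult_mono:
  assumes "x \<preceq> x'" "y \<preceq> y'"
    and "x \<in> carrier A" "x' \<in> carrier A" "y \<in> carrier A" "y' \<in> carrier A"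
  shows "x \<otimes> y \<preceq> x' \<otimes> y'"
  using assms mult_mono_right[of y y' x] mult_mono_right[of x x' y'] le_trans m_comm m_closed
  by metis

lemma mult_le_left: "\<lbrakk>x \<in> carrier A; y \<in> carrier A\<rbrakk> \<Longrightarrow> x \<otimes> y \<preceq> x"
  using mult_mono_right[of y \<one> x] one_greatest by simp

lemma mult_le_right: "\<lbrakk>x \<in> carrier A; y \<in> carrier A\<rbrakk> \<Longrightarrow> x \<otimes> y \<preceq> y"
  using mult_le_left m_comm by metis

lemma imp_eq_one:
  assumes "x \<preceq> y" "x \<in> carrier A" "y \<in> carrier A"
  shows "x \<rightharpoonup> y = \<one>"
proof -
  have "\<one> \<preceq> (x \<rightharpoonup> y)"
    using assms by (simp add: residuation)
  then show ?thesis
    using assms by (meson le_antisym one_greatest imp_closed one_closed)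
qed

text \<open>Since the meet is a term in product and implication, so is the join. This is what makes
  closure under joins automatic for subalgebras.\<close>

lemma join_eq_imp:
  assumes x: "x \<in> carrier A" and y: "y \<in> carrier A"
  shows "x \<curlyvee> y = ((x \<rightharpoonup> y) \<rightharpoonup> y) \<curlywedge> ((y \<rightharpoonup> x) \<rightharpoonup> x)"
proof -
  define p q where "p = x \<rightharpoonup> y" and "q = y \<rightharpoonup> x"
  define u where "u = (p \<rightharpoonup> y) \<curlywedge> (q \<rightharpoonup> x)"
  have c: "p \<in> carrier A" "q \<in> carrier A" "u \<in> carrier A" "x \<curlyvee> y \<in> carrier A"
    "p \<rightharpoonup> y \<in> carrier A" "q \<rightharpoonup> x \<in> carrier A"
    using x y by (simp_all add: p_def q_def u_def imp_closed meet_closed join_closed)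
  have "p \<otimes> x \<preceq> y" "q \<otimes> y \<preceq> x"
    using x y c mult_imp_le m_comm unfolding p_def q_def by metis+
  then have "x \<preceq> u" "y \<preceq> u"
    unfolding u_def using x y c
    by (simp_all add: meet_greatest residuation mult_le_right)
  then have le: "x \<curlyvee> y \<preceq> u"
    using x y c join_least by simp
  have "u \<otimes> p \<preceq> x \<curlyvee> y"
  proof -
    have "p \<otimes> u \<preceq> y"
      using x y c by (metis residuation u_def meet_le1)
    then show ?thesis
      using x y c by (metis le_trans join_ge2 m_comm m_closed)
  qed
  moreover have "u \<otimes> q \<preceq> x \<curlyvee> y"
  proof -
    have "q \<otimes> u \<preceq> x"
      using x y c by (metis residuation u_def meet_le2)
    then show ?thesis
      using x y c by (metis le_trans join_ge1 m_comm m_closed)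
  qed
  \<comment> \<open>By residuation both \<open>p\<close> and \<open>q\<close> lie below
    \<open>u \<rightharpoonup> x \<curlyvee> y\<close>. Prelinearity says
    \<open>p \<curlyvee> q = \<one>\<close>, so this implication is \<open>\<one>\<close> and
    \<open>u\<close> lies below the join.\<close>
  ultimately have "p \<curlyvee> q \<preceq> (u \<rightharpoonup> x \<curlyvee> y)"
    using c by (simp add: join_least residuation imp_closed)
  then have "u \<otimes> \<one> \<preceq> x \<curlyvee> y"
    using x y c by (metis p_def q_def prelinearity residuation one_closed)
  then have "u \<preceq> x \<curlyvee> y"
    using c by simp
  then show ?thesis
    using le c le_antisym unfolding u_def p_def q_def by blast
qed

text \<open>Closure under the lattice operations is derived: meets by \<open>divisibility\<close>,
  joins by \<open>join_eq_imp\<close>. The identities are then inherited.\<close>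

lemma subalgebra:
  assumes S: "S \<subseteq> carrier A" and "\<one> \<in> S" "\<zero> \<in> S"
    and mult: "\<And>x y. \<lbrakk>x \<in> S; y \<in> S\<rbrakk> \<Longrightarrow> x \<otimes> y \<in> S"
    and imp: "\<And>x y. \<lbrakk>x \<in> S; y \<in> S\<rbrakk> \<Longrightarrow> x \<rightharpoonup> y \<in> S"
  shows "bl_algebra (A\<lparr>carrier := S\<rparr>)"
proof -
  have c: "x \<in> carrier A" if "x \<in> S" for x
    using S that by blast
  have meet: "x \<curlywedge> y \<in> S" if "x \<in> S" "y \<in> S" for x y
    using that by (simp add: divisibility c mult imp)
  have join: "x \<curlyvee> y \<in> S" if "x \<in> S" "y \<in> S" for x y
    using that by (simp add: join_eq_imp c meet imp)
  have le: "bl_le (A\<lparr>carrier := S\<rparr>) x y \<longleftrightarrow> x \<preceq> y" for x y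
    by (simp add: bl_le_def)
  show ?thesis
    by (unfold_locales,
        simp_all add: le c assms(2,3) mult imp meet join m_assoc meet_assoc join_assoc
          meet_join_absorb join_meet_absorb zero_least one_greatest residuation
          divisibility[symmetric] prelinearity)
      (simp_all add: c m_comm meet_commute join_commute)
qed

section \<open>Filters and simplicity\<close>

lemma filter_one: "bl_filter A F \<Longrightarrow> \<one> \<in> F"
  unfolding bl_filter_def using one_greatest by blast

lemma filter_eq_carrier_iff:
  assumes "bl_filter A F"
  shows "F = carrier A \<longleftrightarrow> \<zero> \<in> F"
  using assms zero_least zero_closed unfolding bl_filter_def by blast

lemma filter_carrier: "bl_filter A (carrier A)"
  unfolding bl_filter_def by auto

lemma filter_singleton_one: "bl_filter A {\<one>}"
  unfolding bl_filter_def using one_greatest le_antisym by auto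

text \<open>\<open>{\<one>}\<close> and the carrier are always filters, and they differ exactly when
  \<open>\<zero> \<noteq> \<one>\<close>. Having two filters thus means that there is no third one,
  and a filter containing \<open>\<zero>\<close> is the carrier. This form avoids counting.\<close>

lemma simple_iff:
  "simple_bl_algebra A \<longleftrightarrow> \<zero> \<noteq> \<one> \<and> (\<forall>F. bl_filter A F \<longrightarrow> F \<noteq> {\<one>} \<longrightarrow> \<zero> \<in> F)"
    (is "_ \<longleftrightarrow> ?R")
proof
  assume "simple_bl_algebra A"
  then have card: "card {F. bl_filter A F} = 2"
    by (simp add: simple_bl_algebra_def)
  have ne: "\<zero> \<noteq> \<one>"
  proof
    assume "\<zero> = \<one>"
    then have "{F. bl_filter A F} \<subseteq> {carrier A}"
      using filter_one filter_eq_carrier_iff by auto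
    then have "card {F. bl_filter A F} \<le> card {carrier A}"
      by (intro card_mono) auto
    with card show False by simp
  qed
  then have "{\<one>} \<noteq> carrier A"
    using zero_closed by auto
  then have "card {{\<one>}, carrier A} = 2"
    by simp
  \<comment> \<open>An infinite set has cardinality 0, so cardinality 2 forces finiteness.\<close>
  moreover have "finite {F. bl_filter A F}"
    using card by (intro card_ge_0_finite) simp
  ultimately have "{{\<one>}, carrier A} = {F. bl_filter A F}"
    using filter_carrier filter_singleton_one card by (intro card_subset_eq) auto
  then show ?R
    using ne zero_closed by auto
next
  assume R: ?R
  then have "{F. bl_filter A F} = {{\<one>}, carrier A}"
    using filter_carrier filter_singleton_one filter_eq_carrier_iff by auto
  moreover have "{\<one>} \<noteq> carrier A"
    using R zero_closed by auto
  ultimately show "simple_bl_algebra A"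
    using bl_algebra_axioms by (simp add: simple_bl_algebra_def)
qed

end

section \<open>The state operator, its image and its kernel\<close>

context state_morphism_bl_algebra
begin

text \<open>Apply \<open>state_imp\<close> to \<open>\<zero> \<rightharpoonup> \<zero>\<close>,
  which equals \<open>\<one>\<close>.\<close>

lemma state_one: "\<sigma> \<one> = \<one>"
  using state_imp[of \<zero> \<zero>] imp_eq_one[of \<zero> \<zero>] le_refl[of \<zero>] zero_closed
  by (simp add: state_zero bl_le_def)

lemma state_idem: "x \<in> carrier A \<Longrightarrow> \<sigma> (\<sigma> x) = \<sigma> x"
  using state_mult_image[of x \<one>] by (simp add: state_one state_closed)

text \<open>By divisibility an element below \<open>y\<close> is a multiple of \<open>y\<close>, and
  \<sigma> preserves products.\<close>

lemma state_mono:
  assumes "x \<preceq> y" and x: "x \<in> carrier A" and y: "y \<in> carrier A"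
  shows "\<sigma> x \<preceq> \<sigma> y"
proof -
  have "x = y \<otimes> (y \<rightharpoonup> x)"
    using assms divisibility meet_commute unfolding bl_le_def by metis
  then have "\<sigma> x = \<sigma> y \<otimes> \<sigma> (y \<rightharpoonup> x)"
    using x y state_mult imp_closed by metis
  then show ?thesis
    using x y by (simp add: mult_le_left state_closed imp_closed)
qed

lemma image_bl_algebra: "bl_algebra (state_image A \<sigma>)"
  unfolding state_image_def
proof (rule subalgebra)
  show "\<one> \<in> \<sigma> ` carrier A" "\<zero> \<in> \<sigma> ` carrier A"
    using state_one state_zero zero_closed by (metis image_eqI one_closed)+
  fix x y
  assume "x \<in> \<sigma> ` carrier A" "y \<in> \<sigma> ` carrier A"
  then show "x \<otimes> y \<in> \<sigma> ` carrier A" "x \<rightharpoonup> y \<in> \<sigma> ` carrier A"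
    by (elim imageE; metis image_eqI state_mult_image state_imp_image state_closed
        m_closed imp_closed)+
qed (auto simp: state_closed)

lemma filter_image_iff:
  "bl_filter (state_image A \<sigma>) F \<longleftrightarrow> F \<subseteq> \<sigma> ` carrier A \<and> F \<noteq> {} \<and>
    (\<forall>x\<in>F. \<forall>y\<in>F. x \<otimes> y \<in> F) \<and> (\<forall>x\<in>F. \<forall>y\<in>\<sigma> ` carrier A. x \<preceq> y \<longrightarrow> y \<in> F)"
  by (simp add: bl_filter_def state_image_def bl_le_def)

lemma simple_state_iff:
  "simple_state_bl_algebra A \<sigma> \<longleftrightarrow>
    \<zero> \<noteq> \<one> \<and> (\<forall>F. bl_filter (state_image A \<sigma>) F \<longrightarrow> F \<noteq> {\<one>} \<longrightarrow> \<zero> \<in> F)"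
  unfolding simple_state_bl_algebra_def bl_algebra.simple_iff[OF image_bl_algebra]
  by (simp add: state_image_def)

text \<open>Holds because \<sigma> is multiplicative and monotone. It serves twice: with
  \<open>F = {\<one>}\<close> it shows that the kernel is a filter, and in general it pulls filters
  of the image back to \<open>A\<close>.\<close>

lemma filter_vimage:
  assumes F: "bl_filter (state_image A \<sigma>) F"
  shows "bl_filter A {x \<in> carrier A. \<sigma> x \<in> F}"
proof -
  have "\<one> \<in> F"
    using bl_algebra.filter_one[OF image_bl_algebra F] by (simp add: state_image_def)
  then have "\<one> \<in> {x \<in> carrier A. \<sigma> x \<in> F}"
    by (simp add: state_one)
  moreover have "y \<in> {x \<in> carrier A. \<sigma> x \<in> F}"
    if "x \<in> {x \<in> carrier A. \<sigma> x \<in> F}" "y \<in> carrier A" "x \<preceq> y" for x y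
    using that F state_mono[of x y] by (auto simp: filter_image_iff)
  ultimately show ?thesis
    using F unfolding bl_filter_def[of A]
    by (auto simp: filter_image_iff state_mult)
qed

lemma state_kernel_eq_vimage: "state_kernel A \<sigma> = {x \<in> carrier A. \<sigma> x \<in> {\<one>}}"
  by (simp add: state_kernel_def)

lemma filter_kernel: "bl_filter A (state_kernel A \<sigma>)"
proof -
  have "bl_filter (state_image A \<sigma>) {\<one>}"
    using bl_algebra.filter_singleton_one[OF image_bl_algebra] by (simp add: state_image_def)
  then show ?thesis
    unfolding state_kernel_eq_vimage by (rule filter_vimage)
qed

lemma filter_generated_by_image:
  assumes G: "bl_filter A G"
  shows "bl_filter (state_image A \<sigma>) {b \<in> \<sigma> ` carrier A. \<exists>g\<in>G. \<sigma> g \<preceq> b}" (is "bl_filter _ ?F")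
proof -
  have GA: "g \<in> carrier A" if "g \<in> G" for g
    using G that by (auto simp: bl_filter_def)
  have "\<one> \<in> ?F"
    using filter_one[OF G] le_refl[of \<one>] state_one by (force intro: rev_image_eqI)
  moreover have "x \<otimes> y \<in> ?F" if "x \<in> ?F" "y \<in> ?F" for x y
  proof -
    from that obtain g h where gh: "g \<in> G" "h \<in> G" "\<sigma> g \<preceq> x" "\<sigma> h \<preceq> y" by blast
    from that have xy: "x \<in> \<sigma> ` carrier A" "y \<in> \<sigma> ` carrier A" by auto
    then have c: "x \<in> carrier A" "y \<in> carrier A"
      by (auto simp: state_closed)
    \<comment> \<open>The product \<open>g \<otimes> h\<close> is the witness for
      \<open>x \<otimes> y\<close>, by multiplicativity of \<sigma>.\<close>
    have "\<sigma> (g \<otimes> h) \<preceq> x \<otimes> y"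
      using gh c by (simp add: state_mult GA mult_mono state_closed)
    moreover have "g \<otimes> h \<in> G"
      using G gh by (simp add: bl_filter_def)
    moreover have "x \<otimes> y \<in> \<sigma> ` carrier A"
      using xy by (elim imageE) (metis image_eqI state_mult m_closed)
    ultimately show ?thesis by blast
  qed
  moreover have "y \<in> ?F" if "x \<in> ?F" "y \<in> \<sigma> ` carrier A" "x \<preceq> y" for x y
  proof -
    from that obtain g where g: "g \<in> G" "\<sigma> g \<preceq> x" by blast
    have "\<sigma> g \<preceq> y"
      using le_trans[OF g(2) that(3)] that GA[OF g(1)] by (auto simp: state_closed)
    then show ?thesis
      using g that by blast
  qed
  ultimately show ?thesis
    unfolding filter_image_iff by blast
qed

lemma filter_above_kernel_improper:
  assumes G: "bl_filter A G" and K: "state_kernel A \<sigma> \<subseteq> G" and g: "g \<in> G" "\<sigma> g = \<zero>"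
  shows "\<zero> \<in> G"
proof -
  have gA: "g \<in> carrier A"
    using G g by (auto simp: bl_filter_def)
  \<comment> \<open>This meet is used twice: it is the argument of \<sigma> on the right of
    \<open>state_imp\<close>, and by divisibility it is the product
    \<open>g \<otimes> (g \<rightharpoonup> \<zero>)\<close>.\<close>
  have "g \<curlywedge> \<zero> = \<zero>"
    using zero_least[OF gA] meet_commute[OF gA zero_closed] by (simp add: bl_le_def)
  then have "\<sigma> (g \<rightharpoonup> \<zero>) = \<zero> \<rightharpoonup> \<zero>"
    using state_imp[OF gA zero_closed] g by (simp add: state_zero)
  then have "g \<rightharpoonup> \<zero> \<in> G"
    using K gA imp_eq_one[OF le_refl] zero_closed imp_closed by (auto simp: state_kernel_def)
  then have "g \<otimes> (g \<rightharpoonup> \<zero>) \<in> G"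
    using G g by (simp add: bl_filter_def)
  then show ?thesis
    using divisibility[OF gA zero_closed] \<open>g \<curlywedge> \<zero> = \<zero>\<close> by simp
qed

section \<open>Maximality of the kernel against simplicity of the image\<close>

lemma kernel_maximal_if_simple:
  assumes "simple_state_bl_algebra A \<sigma>"
  shows "bl_maximal_filter A (state_kernel A \<sigma>)"
proof -
  from assms have ne: "\<zero> \<noteq> \<one>"
    and simple: "\<And>F. \<lbrakk>bl_filter (state_image A \<sigma>) F; F \<noteq> {\<one>}\<rbrakk> \<Longrightarrow> \<zero> \<in> F"
    unfolding simple_state_iff by blast+
  have "bl_proper_filter A (state_kernel A \<sigma>)"
    using filter_kernel filter_eq_carrier_iff[OF filter_kernel] ne
    by (simp add: bl_proper_filter_def state_kernel_def state_zero)
  moreover have False if proper: "bl_proper_filter A G" and above: "state_kernel A \<sigma> \<subset> G" for G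
  proof -
    have G: "bl_filter A G" "\<zero> \<notin> G"
      using proper filter_eq_carrier_iff by (auto simp: bl_proper_filter_def)
    \<comment> \<open>Strict inclusion supplies \<open>a\<close> with
      \<open>\<sigma> a \<noteq> \<one>\<close>, so the filter generated by the image of
      \<open>G\<close> is not \<open>{\<one>}\<close> and simplicity puts \<open>\<zero>\<close>
      into it.\<close>
    obtain a where a: "a \<in> G" "a \<notin> state_kernel A \<sigma>"
      using above by blast
    then have aA: "a \<in> carrier A"
      using G by (auto simp: bl_filter_def)
    let ?F = "{b \<in> \<sigma> ` carrier A. \<exists>g\<in>G. \<sigma> g \<preceq> b}"
    have "\<sigma> a \<in> ?F" "\<sigma> a \<noteq> \<one>"
      using a aA le_refl[OF state_closed[OF aA]] by (auto simp: state_kernel_def)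
    then have "\<zero> \<in> ?F"
      using simple[OF filter_generated_by_image[OF G(1)]] by blast
    then obtain g where g: "g \<in> G" "\<sigma> g \<preceq> \<zero>" by blast
    have "g \<in> carrier A"
      using G g by (auto simp: bl_filter_def)
    then have "\<sigma> g = \<zero>"
      using g by (meson le_antisym zero_least state_closed zero_closed)
    then show False
      using filter_above_kernel_improper[OF G(1) _ g(1)] above G by blast
  qed
  ultimately show ?thesis
    unfolding bl_maximal_filter_def by blast
qed

lemma simple_if_kernel_maximal:
  assumes "bl_maximal_filter A (state_kernel A \<sigma>)"
  shows "simple_state_bl_algebra A \<sigma>"
  unfolding simple_state_iff
proof (intro conjI allI impI)
  show "\<zero> \<noteq> \<one>"
    using assms filter_eq_carrier_iff[OF filter_kernel] zero_closed state_zero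
    by (auto simp: bl_maximal_filter_def bl_proper_filter_def state_kernel_def)
next
  fix F
  assume F: "bl_filter (state_image A \<sigma>) F" and "F \<noteq> {\<one>}"
  let ?G = "{x \<in> carrier A. \<sigma> x \<in> F}"
  have one: "\<one> \<in> F"
    using bl_algebra.filter_one[OF image_bl_algebra F] by (simp add: state_image_def)
  with \<open>F \<noteq> {\<one>}\<close> obtain b where b: "b \<in> F" "b \<noteq> \<one>" by blast
  \<comment> \<open>Elements of the image are fixed by the idempotent \<sigma>, so \<open>b\<close>
    itself lies in the preimage \<open>?G\<close> and outside the kernel.\<close>
  then have "\<sigma> b = b" "b \<in> carrier A"
    using F by (auto simp: filter_image_iff state_idem state_closed)
  with b have "b \<in> ?G" "b \<notin> state_kernel A \<sigma>"
    by (auto simp: state_kernel_def)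
  moreover have "state_kernel A \<sigma> \<subseteq> ?G"
    using one by (auto simp: state_kernel_def)
  ultimately have "state_kernel A \<sigma> \<subset> ?G"
    by blast
  \<comment> \<open>A filter strictly above a maximal one is improper; \<open>\<zero>\<close> then
    descends to \<open>F\<close> because \<sigma> fixes it.\<close>
  then have "?G = carrier A"
    using assms filter_vimage[OF F] by (auto simp: bl_maximal_filter_def bl_proper_filter_def)
  then have "\<zero> \<in> ?G"
    using zero_closed by simp
  then show "\<zero> \<in> F"
    by (simp add: state_zero)
qed

end

theorem theorem7p3:
  fixes A :: "('a, 'm) bl_signature_scheme" and \<sigma> :: "'a \<Rightarrow> 'a"
  assumes "state_morphism_bl_algebra A \<sigma>"
  shows "simple_state_bl_algebra A \<sigma> \<longleftrightarrow> bl_maximal_filter A (state_kernel A \<sigma>)"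
proof -
  interpret state_morphism_bl_algebra A \<sigma>
    by (rule assms)
  show ?thesis
    using kernel_maximal_if_simple simple_if_kernel_maximal by blast
qed

end
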